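(* Let $R$ be a local ring such that each right singular (resp. each left singular) $2\times 2$ matrix over $R$ can be expressed as a product of idempotent matrices in $M_2(R)$. Then $R$ is a domain. (That is, either of the two hypotheses, the one on right singular matrices or the one on left singular matrices, implies that $R$ is a domain.)
   Context: All rings are nonzero, associative, with identity $1$, and need not be commutative. A ring is local if it has a unique maximal right ideal (equivalently, a unique maximal left ideal). A domain is a (not necessarily commutative) nonzero ring without zero divisors. An element $a$ of a ring $T$ is right singular if its right annihilator $r.ann(a)=\{t\in T: at=0\}$ is nonzero, and left singular if its left annihilator $l.ann(a)=\{t\in T: ta=0\}$ is nonzero; for a $2\times2$ matrix over $R$ these notions are taken in the ring $T=M_2(R)$. *)

theory Defs
  imports "HOL-Analysis.Analysis"
begin

text \<open>
  The ring \<open>R\<close> is an arbitrary type of class \<^class>\<open>ring_1\<close>: associative, with identity,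
  \<open>0 \<noteq> 1\<close>, not assumed commutative.
\<close>

(* Closure under negation follows from b * (- 1) = - b. *)
definition right_ideal :: "'a::ring_1 set \<Rightarrow> bool" where
  "right_ideal I \<longleftrightarrow>
     0 \<in> I \<and> (\<forall>a\<in>I. \<forall>b\<in>I. a + b \<in> I) \<and> (\<forall>a\<in>I. \<forall>r. a * r \<in> I)"

definition maximal_right_ideal :: "'a::ring_1 set \<Rightarrow> bool" where
  "maximal_right_ideal M \<longleftrightarrow>
     right_ideal M \<and> M \<noteq> UNIV \<and>
     (\<forall>I. right_ideal I \<and> M \<subseteq> I \<longrightarrow> I = M \<or> I = UNIV)"

definition is_local_ring :: "'a::ring_1 itself \<Rightarrow> bool" where
  "is_local_ring (_ :: 'a itself) \<longleftrightarrow> (\<exists>!M :: 'a set. maximal_right_ideal M)"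

(* The library classes for domains cannot occur as a conclusion about a given type,
   and the HOL-Algebra locale for domains includes commutativity. *)
definition is_domain :: "'a::ring_1 itself \<Rightarrow> bool" where
  "is_domain (_ :: 'a itself) \<longleftrightarrow> (\<forall>a b :: 'a. a * b = 0 \<longrightarrow> a = 0 \<or> b = 0)"

text \<open>
  Multiplication in the matrix ring is \<open>**\<close>, with identity \<open>mat 1\<close>; the type class
  operation \<open>*\<close> on \<open>'a ^ 'n ^ 'n\<close> is componentwise and plays no role here.
\<close>

definition right_annihilator :: "'a::ring_1 ^ 'n::finite ^ 'n \<Rightarrow> ('a ^ 'n ^ 'n) set" where
  "right_annihilator A = {X. A ** X = 0}"

definition left_annihilator :: "'a::ring_1 ^ 'n::finite ^ 'n \<Rightarrow> ('a ^ 'n ^ 'n) set" where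
  "left_annihilator A = {X. X ** A = 0}"

definition right_singular :: "'a::ring_1 ^ 'n::finite ^ 'n \<Rightarrow> bool" where
  "right_singular A \<longleftrightarrow> right_annihilator A \<noteq> {0}"

definition left_singular :: "'a::ring_1 ^ 'n::finite ^ 'n \<Rightarrow> bool" where
  "left_singular A \<longleftrightarrow> left_annihilator A \<noteq> {0}"

definition idempotent_matrix :: "'a::ring_1 ^ 'n::finite ^ 'n \<Rightarrow> bool" where
  "idempotent_matrix E \<longleftrightarrow> E ** E = E"

(* Allowing the empty product is harmless: it equals mat 1, which is idempotent. *)
definition product_of_idempotents :: "'a::ring_1 ^ 'n::finite ^ 'n \<Rightarrow> bool" where
  "product_of_idempotents A \<longleftrightarrow>
     (\<exists>Es. (\<forall>E\<in>set Es. idempotent_matrix E) \<and> A = foldr (**) Es (mat 1))"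

end

theory Submission
  imports Defs
begin

text \<open>
  Everything rests on the matrices \<open>diag(a, 1)\<close>. If \<open>a * b = 0\<close> with \<open>b \<noteq> 0\<close>, then \<open>diag(a, 1)\<close>
  is right singular, because it annihilates \<open>diag(b, 0)\<close>; if \<open>a * b = 0\<close> with \<open>a \<noteq> 0\<close>, then
  \<open>diag(b, 1)\<close> is left singular, because \<open>diag(a, 0)\<close> annihilates it. However, over a ring whose
  only idempotents are \<open>0\<close> and \<open>1\<close>, such a matrix is rarely a product of idempotents: the first
  factor \<open>E\<close> of a product \<open>A\<close> of idempotents satisfies \<open>E A = A\<close>, and for \<open>A = diag(a, 1)\<close> this
  fixes the second column of \<open>E\<close> so tightly that either \<open>E\<close> is the identity, and can be
  cancelled, or \<open>a = 0\<close>. So among these matrices only \<open>diag(0, 1)\<close> and the identity are products of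
  idempotents (\<open>diag_one_product_of_idempotents\<close>), whereas two nonzero elements with product
  \<open>0\<close> are both different from \<open>0\<close> and \<open>1\<close>.

  A local ring has no idempotent \<open>e\<close> other than \<open>0\<close> and \<open>1\<close> (\<open>local_ring_idempotent\<close>): otherwise
  \<open>e R\<close> and \<open>(1 - e) R\<close> would both be proper, hence both lie in the maximal right ideal, which
  would then contain \<open>e + (1 - e) = 1\<close>.
\<close>

section \<open>Idempotents of a local ring\<close>

lemma right_ideal_eq_UNIV_iff:
  assumes "right_ideal I"
  shows "I = UNIV \<longleftrightarrow> 1 \<in> I"
proof
  assume "1 \<in> I"
  with assms have "1 * r \<in> I" for r
    unfolding right_ideal_def by blast
  then show "I = UNIV" by auto
qed simp

text \<open>
  Zorn's lemma applies because being proper means omitting \<open>1\<close>, a condition inherited by unions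
  of chains.
\<close>

lemma proper_right_ideal_subset_maximal:
  fixes I :: "'a::ring_1 set"
  assumes "right_ideal I" "1 \<notin> I"
  obtains M where "maximal_right_ideal M" "I \<subseteq> M"
proof -
  define P where "P = {K. right_ideal K \<and> I \<subseteq> K \<and> 1 \<notin> K}"
  have "P \<noteq> {}"
    using assms unfolding P_def by auto
  moreover have "\<Union>C \<in> P" if "C \<noteq> {}" and "subset.chain P C" for C
  proof -
    have C: "right_ideal K" "I \<subseteq> K" "1 \<notin> K" if "K \<in> C" for K
      using that \<open>subset.chain P C\<close> unfolding P_def subset.chain_def by auto
    have "a + b \<in> \<Union>C" if "a \<in> \<Union>C" "b \<in> \<Union>C" for a b
    proof -
      obtain K L where KL: "K \<in> C" "L \<in> C" "a \<in> K" "b \<in> L"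
        using \<open>a \<in> \<Union>C\<close> \<open>b \<in> \<Union>C\<close> by blast
      then have "K \<subseteq> L \<or> L \<subseteq> K"
        using \<open>subset.chain P C\<close> unfolding subset_chain_def by blast
      with KL C(1) show ?thesis
        unfolding right_ideal_def by blast
    qed
    moreover have "0 \<in> \<Union>C" "\<forall>a\<in>\<Union>C. \<forall>r. a * r \<in> \<Union>C"
      using C(1) \<open>C \<noteq> {}\<close> unfolding right_ideal_def by blast+
    ultimately have "right_ideal (\<Union>C)"
      unfolding right_ideal_def by blast
    then show ?thesis
      using C(2,3) \<open>C \<noteq> {}\<close> unfolding P_def by blast
  qed
  ultimately obtain M where M: "M \<in> P" "\<forall>K\<in>P. M \<subseteq> K \<longrightarrow> K = M"
    using subset_Zorn_nonempty[of P] by metis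
  have "maximal_right_ideal M"
    unfolding maximal_right_ideal_def
  proof (intro conjI allI impI)
    show "right_ideal M" "M \<noteq> UNIV"
      using M(1) unfolding P_def by auto
    fix K :: "'a set"
    assume K: "right_ideal K \<and> M \<subseteq> K"
    show "K = M \<or> K = UNIV"
    proof (cases "1 \<in> K")
      case True
      then show ?thesis using K right_ideal_eq_UNIV_iff by blast
    next
      case False
      then have "K \<in> P"
        using K M(1) unfolding P_def by auto
      then show ?thesis using K M(2) by blast
    qed
  qed
  with M(1) that show thesis
    unfolding P_def by blast
qed

lemma right_ideal_principal: "right_ideal (range ((*) a))"
  unfolding right_ideal_def
proof (intro conjI)
  show "0 \<in> range ((*) a)"
    by (metis mult_zero_right rangeI)
  show "\<forall>x\<in>range ((*) a). \<forall>y\<in>range ((*) a). x + y \<in> range ((*) a)"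
    by (auto simp flip: distrib_left)
  show "\<forall>x\<in>range ((*) a). \<forall>r. x * r \<in> range ((*) a)"
    by (auto simp: mult.assoc)
qed

text \<open>Left multiplication with an idempotent \<open>e\<close> fixes every element of \<open>e R\<close>.\<close>

lemma idempotent_principal_proper:
  fixes e :: "'a::ring_1"
  assumes "e * e = e" "e \<noteq> 1"
  shows "1 \<notin> range ((*) e)"
proof
  assume "1 \<in> range ((*) e)"
  then obtain r where r: "1 = e * r" by blast
  have "e = e * (e * r)" by (simp flip: r)
  also have "\<dots> = e * e * r" by (simp only: mult.assoc)
  also have "\<dots> = 1" by (simp only: assms(1) flip: r)
  finally show False using assms(2) by simp
qed

lemma local_ring_idempotent:
  fixes e :: "'a::ring_1"
  assumes local: "is_local_ring TYPE('a)" and idem: "e * e = e"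
  shows "e = 0 \<or> e = 1"
proof (rule ccontr)
  assume "\<not> (e = 0 \<or> e = 1)"
  then have "e \<noteq> 1" "1 - e \<noteq> 1" by auto
  moreover have "(1 - e) * (1 - e) = 1 - e"
    using idem by (simp add: algebra_simps)
  ultimately obtain M N where
      M: "maximal_right_ideal M" "range ((*) e) \<subseteq> M" and
      N: "maximal_right_ideal N" "range ((*) (1 - e)) \<subseteq> N"
    using idem by (metis proper_right_ideal_subset_maximal right_ideal_principal
        idempotent_principal_proper)
  have "M = N"
    using local M(1) N(1) unfolding is_local_ring_def by blast
  moreover have "e \<in> range ((*) e)" "1 - e \<in> range ((*) (1 - e))"
    by (metis mult_1_right rangeI)+
  ultimately have "e \<in> M" "1 - e \<in> M"
    using M(2) N(2) by auto
  moreover have "right_ideal M" "M \<noteq> UNIV"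
    using M(1) unfolding maximal_right_ideal_def by auto
  ultimately have "e + (1 - e) \<in> M" "1 \<notin> M"
    using right_ideal_eq_UNIV_iff unfolding right_ideal_def by blast+
  then show False by simp
qed

section \<open>Two by two diagonal matrices\<close>

definition diag2 :: "'a::ring_1 \<Rightarrow> 'a \<Rightarrow> 'a ^ 2 ^ 2" where
  "diag2 a d = vector [vector [a, 0], vector [0, d]]"

lemma diag2_nth [simp]:
  "diag2 a d $ 1 $ 1 = a" "diag2 a d $ 1 $ 2 = 0"
  "diag2 a d $ 2 $ 1 = 0" "diag2 a d $ 2 $ 2 = d"
  by (simp_all add: diag2_def)

lemma matrix_mult_2_nth:
  fixes A B :: "'a::ring_1 ^ 2 ^ 2"
  shows "(A ** B) $ i $ j = A $ i $ 1 * B $ 1 $ j + A $ i $ 2 * B $ 2 $ j"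
  by (simp add: matrix_matrix_mult_def sum_2)

lemma diag2_mult: "diag2 a d ** diag2 b c = diag2 (a * b) (d * c)"
  by (simp add: vec_eq_iff forall_2 matrix_mult_2_nth)

lemma diag2_eq_iff: "diag2 a d = diag2 b c \<longleftrightarrow> a = b \<and> d = c"
  by (auto simp: vec_eq_iff forall_2)

lemma diag2_zero: "diag2 0 0 = 0"
  by (simp add: vec_eq_iff forall_2)

lemma diag2_one: "diag2 1 1 = mat 1"
  by (simp add: vec_eq_iff forall_2 mat_def)

lemma right_singular_diag2:
  assumes "a * b = 0" "b \<noteq> 0"
  shows "right_singular (diag2 a d)"
proof -
  have "diag2 b 0 \<in> right_annihilator (diag2 a d)"
    using assms(1) by (simp add: right_annihilator_def diag2_mult diag2_zero)
  moreover have "diag2 b 0 \<noteq> 0"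
    using assms(2) by (simp add: diag2_eq_iff flip: diag2_zero)
  ultimately show ?thesis
    unfolding right_singular_def by blast
qed

lemma left_singular_diag2:
  assumes "a * b = 0" "a \<noteq> 0"
  shows "left_singular (diag2 b d)"
proof -
  have "diag2 a 0 \<in> left_annihilator (diag2 b d)"
    using assms(1) by (simp add: left_annihilator_def diag2_mult diag2_zero)
  moreover have "diag2 a 0 \<noteq> 0"
    using assms(2) by (simp add: diag2_eq_iff flip: diag2_zero)
  ultimately show ?thesis
    unfolding left_singular_def by blast
qed

section \<open>Products of idempotents\<close>

text \<open>
  Comparing entries in \<open>E ** diag(a, 1) = diag(a, 1)\<close> shows that the second column of \<open>E\<close> is
  \<open>(0, 1)\<close>. Then \<open>E\<close> is lower triangular, so its corner \<open>p\<close> is an idempotent, and it satisfies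
  \<open>p * a = a\<close>. If \<open>p = 0\<close>, this forces \<open>a = 0\<close>; if \<open>p = 1\<close>, idempotency of \<open>E\<close> kills the
  remaining entry.
\<close>

lemma idempotent_fixing_diag_one:
  fixes E :: "'a::ring_1 ^ 2 ^ 2"
  assumes trivial: "\<And>e :: 'a. e * e = e \<Longrightarrow> e = 0 \<or> e = 1"
    and idem: "idempotent_matrix E"
    and fixed: "E ** diag2 a 1 = diag2 a 1"
  shows "a = 0 \<or> E = mat 1"
proof -
  have col: "E $ 1 $ 2 = 0" "E $ 2 $ 2 = 1" and pa: "E $ 1 $ 1 * a = a"
    using fixed by (auto simp: vec_eq_iff forall_2 matrix_mult_2_nth)
  have p: "E $ 1 $ 1 * E $ 1 $ 1 = E $ 1 $ 1" and rp: "E $ 2 $ 1 * E $ 1 $ 1 = 0"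
    using idem col by (auto simp: idempotent_matrix_def vec_eq_iff forall_2 matrix_mult_2_nth)
  from trivial[OF p] show ?thesis
  proof
    assume "E $ 1 $ 1 = 0"
    with pa show ?thesis by simp
  next
    assume "E $ 1 $ 1 = 1"
    with rp col have "E = diag2 1 1"
      by (simp add: vec_eq_iff forall_2)
    then show ?thesis by (simp add: diag2_one)
  qed
qed

lemma diag_one_product_of_idempotents:
  fixes a :: "'a::ring_1"
  assumes trivial: "\<And>e :: 'a. e * e = e \<Longrightarrow> e = 0 \<or> e = 1"
    and prod: "product_of_idempotents (diag2 a 1)"
  shows "a = 0 \<or> a = 1"
proof -
  have "a = 0 \<or> a = 1"
    if "\<forall>E\<in>set Es. idempotent_matrix E" "diag2 a 1 = foldr (**) Es (mat 1)" for Es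
    using that
  proof (induction Es)
    case Nil
    then show ?case by (simp add: diag2_eq_iff flip: diag2_one)
  next
    case (Cons E Es)
    then have E: "idempotent_matrix E" and A: "diag2 a 1 = E ** foldr (**) Es (mat 1)"
      by simp_all
    have "E ** diag2 a 1 = diag2 a 1"
      using E unfolding A idempotent_matrix_def by (simp add: matrix_mul_assoc)
    with trivial E have "a = 0 \<or> E = mat 1"
      by (rule idempotent_fixing_diag_one)
    then show ?case
      using Cons A by auto
  qed
  with prod show ?thesis
    unfolding product_of_idempotents_def by blast
qed

theorem theorem9:
  assumes "is_local_ring TYPE('a::ring_1)"
  shows "((\<forall>A :: 'a ^ 2 ^ 2. right_singular A \<longrightarrow> product_of_idempotents A)
            \<longrightarrow> is_domain TYPE('a))
       \<and> ((\<forall>A :: 'a ^ 2 ^ 2. left_singular A \<longrightarrow> product_of_idempotents A)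
            \<longrightarrow> is_domain TYPE('a))"
proof -
  have diag: "a = 0 \<or> a = 1" if "product_of_idempotents (diag2 a 1)" for a :: 'a
    using local_ring_idempotent[OF assms] that by (rule diag_one_product_of_idempotents)
  show ?thesis
    unfolding is_domain_def
  proof (intro conjI impI allI)
    fix a b :: 'a
    assume hyp: "\<forall>A :: 'a ^ 2 ^ 2. right_singular A \<longrightarrow> product_of_idempotents A"
      and ab: "a * b = 0"
    show "a = 0 \<or> b = 0"
    proof (cases "b = 0")
      case False
      with hyp ab have "a = 0 \<or> a = 1"
        by (intro diag) (simp add: right_singular_diag2)
      with ab show ?thesis by auto
    qed simp
  next
    fix a b :: 'a
    assume hyp: "\<forall>A :: 'a ^ 2 ^ 2. left_singular A \<longrightarrow> product_of_idempotents A"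
      and ab: "a * b = 0"
    show "a = 0 \<or> b = 0"
    proof (cases "a = 0")
      case False
      with hyp ab have "b = 0 \<or> b = 1"
        by (intro diag) (simp add: left_singular_diag2)
      with ab show ?thesis by auto
    qed simp
  qed
qed

end
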